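(* Let $\Gamma$ be a Carter diagram, $S=\{\tau_1,\dots,\tau_l\}\subset\varPhi$ a $\Gamma$-set, $L$ the linear span of $S$, $\gamma\in\varPhi$ a linkage root for $S$, and $L(\gamma)$ the linear span of $S\cup\{\gamma\}$. (i) Let $\theta\in L(\gamma)$ be a root (i.e. $\theta\in\varPhi\cap L(\gamma)$) and let $\theta^{\nabla}$ be its linkage label vector. Then $\theta$ is a linkage root (i.e. $\theta$ is linearly independent of the roots of $S$) if and only if $$\mathscr{B}^{\vee}_{\Gamma}(\theta^{\nabla})<2.$$ (ii) Let $\theta\in L(\gamma)$ be a root connected with only one $\tau_i\in S$, i.e. $(\theta,\tau_i)\in\{-1,1\}$ and $(\theta,\tau_j)=0$ for all $j\neq i$. Then $\theta$ is a linkage root if and only if $$b^{\vee}_{ii}<2,$$ where $b^{\vee}_{ii}$ is the $i$-th diagonal element of $B_{\Gamma}^{-1}$.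
   Context: $\varPhi$ is a finite root system with simply-laced Dynkin diagram, with inner product $(\cdot,\cdot)$ induced by its Cartan matrix, so $(\alpha,\alpha)=2$ for every root $\alpha$. A Carter diagram $\Gamma$ is a graph with solid and dotted edges whose nodes correspond one-to-one to a set of linearly independent (not necessarily simple) roots $\{\tau_1,\dots,\tau_l\}$ in such a root system, where $\tau_i,\tau_j$ ($i\ne j$) are joined by a solid edge iff $(\tau_i,\tau_j)=-1$, by a dotted edge iff $(\tau_i,\tau_j)=1$, and not joined iff $(\tau_i,\tau_j)=0$, and such that every subdiagram that is a cycle has an even number of nodes. Such a set of roots is called a $\Gamma$-set. Dynkin diagrams are particular Carter diagrams. The partial Cartan matrix is $B_\Gamma=((\tau_i,\tau_j))_{i,j=1}^l$; it depends only on $\Gamma$ and is positive definite. $\mathscr{B}^{\vee}_{\Gamma}$ is the quadratic form with matrix $B_\Gamma^{-1}$: $\mathscr{B}^{\vee}_\Gamma(v)={}^t v\,B_\Gamma^{-1}v$. A linkage root for $S$ is a root $\gamma\in\varPhi$ such that $S\cup\{\gamma\}$ is linearly independent. For a root $\theta$, the linkage label vector is the column $\theta^{\nabla}=((\theta,\tau_1),\dots,(\theta,\tau_l))^t$. *)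

theory Defs
  imports "HOL-Analysis.Analysis"
begin

definition cartan_num :: "'a::euclidean_space \<Rightarrow> 'a \<Rightarrow> real" where
  "cartan_num \<beta> \<alpha> = 2 * (\<beta> \<bullet> \<alpha>) / (\<alpha> \<bullet> \<alpha>)"

definition root_system :: "'a::euclidean_space set \<Rightarrow> bool" where
  "root_system \<Phi> \<longleftrightarrow>
     finite \<Phi> \<and> 0 \<notin> \<Phi> \<and> span \<Phi> = UNIV \<and>
     (\<forall>\<alpha>\<in>\<Phi>. \<forall>c::real. c *\<^sub>R \<alpha> \<in> \<Phi> \<longleftrightarrow> c = 1 \<or> c = - 1) \<and>
     (\<forall>\<alpha>\<in>\<Phi>. \<forall>\<beta>\<in>\<Phi>. \<beta> - cartan_num \<beta> \<alpha> *\<^sub>R \<alpha> \<in> \<Phi>) \<and>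
     (\<forall>\<alpha>\<in>\<Phi>. \<forall>\<beta>\<in>\<Phi>. cartan_num \<beta> \<alpha> \<in> \<int>)"

definition simple_roots :: "'a::euclidean_space set \<Rightarrow> 'a set \<Rightarrow> bool" where
  "simple_roots \<Phi> \<Delta> \<longleftrightarrow>
     \<Delta> \<subseteq> \<Phi> \<and> independent \<Delta> \<and>
     (\<forall>\<beta>\<in>\<Phi>. \<exists>c::'a \<Rightarrow> int. \<beta> = (\<Sum>\<alpha>\<in>\<Delta>. real_of_int (c \<alpha>) *\<^sub>R \<alpha>) \<and>
        ((\<forall>\<alpha>\<in>\<Delta>. 0 \<le> c \<alpha>) \<or> (\<forall>\<alpha>\<in>\<Delta>. c \<alpha> \<le> 0)))"

text \<open>In the Dynkin diagram on \<open>\<Delta>\<close>, distinct nodes \<open>\<alpha>\<close>, \<open>\<beta>\<close> are joined by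
  \<open>cartan_num \<alpha> \<beta> * cartan_num \<beta> \<alpha>\<close> edges.\<close>

definition simply_laced_dynkin :: "'a::euclidean_space set \<Rightarrow> bool" where
  "simply_laced_dynkin \<Delta> \<longleftrightarrow>
     (\<forall>\<alpha>\<in>\<Delta>. \<forall>\<beta>\<in>\<Delta>. \<alpha> \<noteq> \<beta> \<longrightarrow> cartan_num \<alpha> \<beta> * cartan_num \<beta> \<alpha> \<in> {0, 1})"

text \<open>The last conjunct fixes the scale of the inner product: it is the one induced by the
  Cartan matrix (see \<open>cartan_num_eq_inner\<close>).\<close>

definition simply_laced_root_system :: "'a::euclidean_space set \<Rightarrow> bool" where
  "simply_laced_root_system \<Phi> \<longleftrightarrow>
     root_system \<Phi> \<and>
     (\<exists>\<Delta>. simple_roots \<Phi> \<Delta> \<and> simply_laced_dynkin \<Delta>) \<and>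
     (\<forall>\<alpha>\<in>\<Phi>. \<alpha> \<bullet> \<alpha> = 2)"

lemma cartan_num_eq_inner:
  assumes "simply_laced_root_system \<Phi>" "\<alpha> \<in> \<Phi>"
  shows "cartan_num \<beta> \<alpha> = \<beta> \<bullet> \<alpha>"
  using assms by (simp add: simply_laced_root_system_def cartan_num_def)

text \<open>The nodes of a diagram are all elements of the finite type \<open>'n\<close>, so that
  \<open>l = CARD('n)\<close>; an edge is the set of its two end points.\<close>

record 'n diagram =
  solid :: "'n set set"
  dotted :: "'n set set"

definition wf_diagram :: "'n diagram \<Rightarrow> bool" where
  "wf_diagram \<Gamma> \<longleftrightarrow> (\<forall>e \<in> solid \<Gamma> \<union> dotted \<Gamma>. card e = 2) \<and> solid \<Gamma> \<inter> dotted \<Gamma> = {}"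

definition cycle_in :: "'n diagram \<Rightarrow> 'n list \<Rightarrow> bool" where
  "cycle_in \<Gamma> vs \<longleftrightarrow>
     3 \<le> length vs \<and> distinct vs \<and>
     (\<forall>k < length vs. {vs ! k, vs ! (Suc k mod length vs)} \<in> solid \<Gamma> \<union> dotted \<Gamma>)"

text \<open>A \<open>\<Gamma>\<close>-set \<open>S\<close> is given by the bijection \<open>\<tau>\<close> from the nodes of \<open>\<Gamma>\<close> onto
  \<open>S = range \<tau>\<close>.\<close>

definition Gamma_set ::
  "'a::euclidean_space set \<Rightarrow> 'n::finite diagram \<Rightarrow> ('n \<Rightarrow> 'a) \<Rightarrow> bool" where
  "Gamma_set \<Phi> \<Gamma> \<tau> \<longleftrightarrow>
     range \<tau> \<subseteq> \<Phi> \<and> inj \<tau> \<and> independent (range \<tau>) \<and>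
     (\<forall>i j. i \<noteq> j \<longrightarrow>
        ({i, j} \<in> solid \<Gamma> \<longleftrightarrow> \<tau> i \<bullet> \<tau> j = - 1) \<and>
        ({i, j} \<in> dotted \<Gamma> \<longleftrightarrow> \<tau> i \<bullet> \<tau> j = 1) \<and>
        ({i, j} \<notin> solid \<Gamma> \<union> dotted \<Gamma> \<longleftrightarrow> \<tau> i \<bullet> \<tau> j = 0))"

text \<open>The root system in which the diagram is realised is a parameter, since one cannot
  quantify over the ambient space.\<close>

definition carter_diagram ::
  "'a::euclidean_space set \<Rightarrow> 'n::finite diagram \<Rightarrow> bool" where
  "carter_diagram \<Phi> \<Gamma> \<longleftrightarrow>
     simply_laced_root_system \<Phi> \<and> wf_diagram \<Gamma> \<and>
     (\<exists>\<tau>. Gamma_set \<Phi> \<Gamma> \<tau>) \<and>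
     (\<forall>vs. cycle_in \<Gamma> vs \<longrightarrow> even (length vs))"

definition partial_cartan :: "('n::finite \<Rightarrow> 'a::euclidean_space) \<Rightarrow> real^'n^'n" where
  "partial_cartan \<tau> = (\<chi> i j. \<tau> i \<bullet> \<tau> j)"

text \<open>The partial Cartan matrix depends only on \<open>\<Gamma>\<close>.\<close>

lemma partial_cartan_entry:
  assumes "simply_laced_root_system \<Phi>" "Gamma_set \<Phi> \<Gamma> \<tau>"
  shows "partial_cartan \<tau> $ i $ j =
    (if i = j then 2 else if {i, j} \<in> solid \<Gamma> then - 1
     else if {i, j} \<in> dotted \<Gamma> then 1 else 0)"
proof (cases "i = j")
  case True
  then show ?thesis using assms
    by (auto simp: partial_cartan_def Gamma_set_def simply_laced_root_system_def)
next
  case False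
  with assms(2) have "{i, j} \<in> solid \<Gamma> \<longleftrightarrow> \<tau> i \<bullet> \<tau> j = - 1"
    "{i, j} \<in> dotted \<Gamma> \<longleftrightarrow> \<tau> i \<bullet> \<tau> j = 1"
    "{i, j} \<notin> solid \<Gamma> \<union> dotted \<Gamma> \<longleftrightarrow> \<tau> i \<bullet> \<tau> j = 0"
    unfolding Gamma_set_def by blast+
  with False show ?thesis by (auto simp: partial_cartan_def)
qed

definition inverse_form :: "('n::finite \<Rightarrow> 'a::euclidean_space) \<Rightarrow> real^'n \<Rightarrow> real" where
  "inverse_form \<tau> v = v \<bullet> (matrix_inv (partial_cartan \<tau>) *v v)"

text \<open>Linear independence of \<open>S \<union> {\<gamma>}\<close> is meant for families: without \<open>\<gamma> \<notin> S\<close>, every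
  element of an independent \<open>S\<close> would qualify.\<close>

definition linkage_root :: "'a::euclidean_space set \<Rightarrow> 'a set \<Rightarrow> 'a \<Rightarrow> bool" where
  "linkage_root \<Phi> S \<gamma> \<longleftrightarrow> \<gamma> \<in> \<Phi> \<and> \<gamma> \<notin> S \<and> independent (S \<union> {\<gamma>})"

definition linkage_label :: "('n::finite \<Rightarrow> 'a::euclidean_space) \<Rightarrow> 'a \<Rightarrow> real^'n" where
  "linkage_label \<tau> \<theta> = (\<chi> i. \<theta> \<bullet> \<tau> i)"

end

(* The quadratic form of the inverse Gram matrix, evaluated at the label vector of \<theta>, is the
   squared length of the orthogonal projection of \<theta> onto span S. It is therefore at most
   (\<theta>,\<theta>) = 2, with equality exactly when \<theta> lies in span S. *)
theory Submission
  imports Defs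
begin

text \<open>This turns solving a linear system with the Gram matrix into finding a vector of the
  span with prescribed labels.\<close>

lemma partial_cartan_mult:
  "partial_cartan \<tau> *v c = linkage_label \<tau> (\<Sum>j\<in>UNIV. c $ j *\<^sub>R \<tau> j)"
  by (simp add: vec_eq_iff partial_cartan_def linkage_label_def matrix_vector_mult_def
      inner_sum_left inner_sum_right inner_commute mult.commute)

lemma inner_linkage_label:
  "c \<bullet> linkage_label \<tau> x = (\<Sum>j\<in>UNIV. c $ j *\<^sub>R \<tau> j) \<bullet> x"
  by (simp add: inner_vec_def linkage_label_def inner_sum_left inner_sum_right inner_commute)

text \<open>Independence of a set attaches coefficients to vectors; injectivity of
  \<open>\<tau>\<close> allows them to be indexed by nodes instead.\<close>

lemma linear_combination_eq_0_iff:
  fixes \<tau> :: "'n::finite \<Rightarrow> 'a::real_vector"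
  assumes "inj \<tau>" "independent (range \<tau>)"
  shows "(\<Sum>j\<in>UNIV. c $ j *\<^sub>R \<tau> j) = 0 \<longleftrightarrow> c = 0"
proof
  assume zero: "(\<Sum>j\<in>UNIV. c $ j *\<^sub>R \<tau> j) = 0"
  have "(\<Sum>v\<in>range \<tau>. (c $ inv \<tau> v) *\<^sub>R v) = 0"
    using zero \<open>inj \<tau>\<close> by (simp add: sum.reindex)
  then have "c $ inv \<tau> (\<tau> i) = 0" for i
    by (intro independentD[OF assms(2), where t = "range \<tau>" and u = "\<lambda>v. c $ inv \<tau> v"]) auto
  then show "c = 0"
    using \<open>inj \<tau>\<close> by (simp add: vec_eq_iff)
qed simp

text \<open>The Gram matrix is positive definite: its quadratic form at \<open>c\<close> is the
  squared length of the combination with coefficients \<open>c\<close>. Hence its kernel is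
  trivial.\<close>

lemma invertible_partial_cartan:
  assumes "inj \<tau>" "independent (range \<tau>)"
  shows "invertible (partial_cartan \<tau>)"
proof -
  have "c = 0" if "partial_cartan \<tau> *v c = 0" for c
  proof -
    let ?p = "\<Sum>j\<in>UNIV. c $ j *\<^sub>R \<tau> j"
    have "?p \<bullet> ?p = c \<bullet> (partial_cartan \<tau> *v c)"
      by (simp add: partial_cartan_mult inner_linkage_label)
    with that show "c = 0"
      using linear_combination_eq_0_iff[OF assms] by simp
  qed
  then show ?thesis
    by (simp add: invertible_left_inverse matrix_left_invertible_ker)
qed

text \<open>\<open>matrix_inv\<close> is a Hilbert choice, and invertibility supplies the witness
  that makes the choice a genuine inverse.\<close>

lemma matrix_mul_matrix_inv:
  assumes "invertible A"
  shows "A ** matrix_inv A = mat 1"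
  using someI_ex[OF assms[unfolded invertible_def]] by (simp add: matrix_inv_def)

lemma inverse_form_less_iff:
  assumes "inj \<tau>" "independent (range \<tau>)"
  shows "inverse_form \<tau> (linkage_label \<tau> \<theta>) < \<theta> \<bullet> \<theta> \<longleftrightarrow> \<theta> \<notin> span (range \<tau>)"
proof -
  \<comment> \<open>\<open>c\<close> solves the normal equations, so \<open>p\<close> below is the
    orthogonal projection of \<theta> onto the span.\<close>
  define c where "c = matrix_inv (partial_cartan \<tau>) *v linkage_label \<tau> \<theta>"
  define p where "p = (\<Sum>j\<in>UNIV. c $ j *\<^sub>R \<tau> j)"
  have p_span: "p \<in> span (range \<tau>)"
    unfolding p_def by (intro span_sum span_scale span_base) auto
  have label_p: "linkage_label \<tau> p = linkage_label \<tau> \<theta>"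
    using matrix_mul_matrix_inv[OF invertible_partial_cartan[OF assms]]
    by (simp add: p_def c_def matrix_vector_mul_assoc flip: partial_cartan_mult)
  have "inverse_form \<tau> (linkage_label \<tau> \<theta>) = p \<bullet> \<theta>"
    using inner_linkage_label[of c \<tau> \<theta>]
    by (simp add: inverse_form_def p_def inner_commute flip: c_def)
  \<comment> \<open>Both sides are the inner product of \<open>c\<close> with the label vector
    shared by \<theta> and \<open>p\<close>.\<close>
  moreover have "p \<bullet> \<theta> = p \<bullet> p"
    using label_p inner_linkage_label[of c \<tau>] by (metis p_def)
  ultimately have form: "\<theta> \<bullet> \<theta> - inverse_form \<tau> (linkage_label \<tau> \<theta>) = (\<theta> - p) \<bullet> (\<theta> - p)"
    by (simp add: inner_diff inner_commute)
  have "orthogonal (\<theta> - p) v" if "v \<in> range \<tau>" for v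
    using label_p that by (auto simp: vec_eq_iff linkage_label_def orthogonal_def inner_diff_left)
  then have orth: "orthogonal (\<theta> - p) v" if "v \<in> span (range \<tau>)" for v
    using orthogonal_to_span that by blast
  \<comment> \<open>Here \<open>\<theta> - p\<close> lies in the span and is thus orthogonal to
    itself.\<close>
  have "\<theta> = p" if "\<theta> \<in> span (range \<tau>)"
    using orth[OF span_diff[OF that p_span]] by (simp add: orthogonal_self)
  with p_span have "\<theta> \<in> span (range \<tau>) \<longleftrightarrow> (\<theta> - p) \<bullet> (\<theta> - p) = 0"
    by auto
  with form show ?thesis
    using inner_ge_zero[of "\<theta> - p"] by linarith
qed

text \<open>An element of \<open>S\<close> already lies in its span, so one non-membership covers
  both \<open>\<theta> \<notin> S\<close> and the independence of the enlarged set.\<close>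

lemma linkage_root_iff:
  assumes "independent S" "\<theta> \<in> \<Phi>"
  shows "linkage_root \<Phi> S \<theta> \<longleftrightarrow> \<theta> \<notin> span S"
  using assms by (auto simp: linkage_root_def independent_insert span_base)

text \<open>For part (ii): a label vector with a single nonzero entry picks out one diagonal entry
  of the inverse.\<close>

lemma inverse_form_axis:
  "inverse_form \<tau> (axis i a) = a\<^sup>2 * matrix_inv (partial_cartan \<tau>) $ i $ i"
  by (simp add: inverse_form_def inner_axis' matrix_vector_mul_component inner_axis power2_eq_square)

theorem theorem3p3:
  fixes \<Phi> S :: "'a::euclidean_space set"
    and \<Gamma> :: "'n::finite diagram"
    and \<tau> :: "'n \<Rightarrow> 'a"
    and \<gamma> :: 'a
  assumes "simply_laced_root_system \<Phi>"
    and "carter_diagram \<Phi> \<Gamma>"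
    and "Gamma_set \<Phi> \<Gamma> \<tau>"
    and "S = range \<tau>"
    and "linkage_root \<Phi> S \<gamma>"
  shows "(\<forall>\<theta> \<in> \<Phi> \<inter> span (S \<union> {\<gamma>}).
            linkage_root \<Phi> S \<theta> \<longleftrightarrow> inverse_form \<tau> (linkage_label \<tau> \<theta>) < 2) \<and>
         (\<forall>\<theta> \<in> \<Phi> \<inter> span (S \<union> {\<gamma>}). \<forall>i.
            \<theta> \<bullet> \<tau> i \<in> {- 1, 1} \<and> (\<forall>j. j \<noteq> i \<longrightarrow> \<theta> \<bullet> \<tau> j = 0) \<longrightarrow>
            (linkage_root \<Phi> S \<theta> \<longleftrightarrow> matrix_inv (partial_cartan \<tau>) $ i $ i < 2))"
proof -
  from assms have \<tau>: "inj \<tau>" "independent (range \<tau>)"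
    by (simp_all add: Gamma_set_def)
  \<comment> \<open>The bound 2 is the squared length of \<theta>, common to all roots.\<close>
  have form: "linkage_root \<Phi> S \<theta> \<longleftrightarrow> inverse_form \<tau> (linkage_label \<tau> \<theta>) < 2"
    if "\<theta> \<in> \<Phi>" for \<theta>
    using inverse_form_less_iff[OF \<tau>, of \<theta>] linkage_root_iff[OF \<tau>(2) that] that assms(1,4)
    by (simp add: simply_laced_root_system_def)
  have diag: "inverse_form \<tau> (linkage_label \<tau> \<theta>) = matrix_inv (partial_cartan \<tau>) $ i $ i"
    if "\<theta> \<bullet> \<tau> i \<in> {- 1, 1}" "\<forall>j. j \<noteq> i \<longrightarrow> \<theta> \<bullet> \<tau> j = 0" for \<theta> i
  proof -
    \<comment> \<open>The remaining label is 1 or -1, and its sign disappears on squaring.\<close>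
    have "linkage_label \<tau> \<theta> = axis i (\<theta> \<bullet> \<tau> i)"
      using that(2) by (simp add: vec_eq_iff linkage_label_def axis_def)
    with that(1) show ?thesis
      by (auto simp: inverse_form_axis)
  qed
  show ?thesis
    using form diag by (metis IntD1)
qed

end
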